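(* Let $x_1,\dots,x_n\in\mathbb{M}_r$ be points of the hyperboloid model. Define the matrix $X\in\mathbb{R}^{n\times r}$ by $X^Te_i=\vec{x}_i$ (so the $i$-th row of $X$ is $\vec{x}_i$) and the vector $u\in\mathbb{R}^n$ by $u_i=x_{0,i}$. Then $$\left.\nabla_{\vec{z}}\Psi(z;x_1,\dots,x_n)\right|_{\vec{z}=0}=-2\sum_{i=1}^n x_{0,i}\,\vec{x}_i=-2X^Tu .$$
   Context: Let $Q$ be the $(r+1)\times(r+1)$ diagonal matrix, indices $0,\dots,r$, with $Q_{00}=1$ and $Q_{ii}=-1$ for $i>0$. The hyperboloid model is $\mathbb{M}_r=\{x\in\mathbb{R}^{r+1}: x^TQx=1,\ x_0>0\}$ with distance $d_H(x,y)=\operatorname{acosh}(x^TQy)$. For $x_i\in\mathbb{M}_r$, $x_{0,i}$ denotes its $0$-th coordinate and $\vec{x}_i\in\mathbb{R}^r$ the vector of its remaining coordinates, so $x_{0,i}=\sqrt{1+\|\vec{x}_i\|^2}$. Define $$\Psi(z;x_1,\dots,x_n)=\sum_{i=1}^n\sinh^2(d_H(x_i,z)),\qquad z\in\mathbb{M}_r,$$ regarded as a function of $\vec{z}\in\mathbb{R}^r$ through $z=(\sqrt{1+\|\vec{z}\|^2},\vec{z})$. $e_i$ is the $i$-th standard basis vector of $\mathbb{R}^n$. *)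

theory Defs
  imports "HOL-Analysis.Analysis"
begin

text \<open>
  The index set \<open>0, \<dots>, r\<close> of the ambient space is rendered as the type \<open>'r option\<close> with
  \<open>CARD('r) = r\<close>: \<open>None\<close> is the index \<open>0\<close>, and \<open>Some j\<close> are the remaining \<open>r\<close> indices.
\<close>

definition Qmat :: "real ^ ('r::finite) option ^ 'r option" where
  "Qmat = (\<chi> i j. if i = j then (if i = None then 1 else - 1) else 0)"

definition hyperboloid :: "(real ^ ('r::finite) option) set" where
  "hyperboloid = {x. x \<bullet> (Qmat *v x) = 1 \<and> x $ None > 0}"

definition dist_hyp :: "real ^ ('r::finite) option \<Rightarrow> real ^ 'r option \<Rightarrow> real" where
  "dist_hyp x y = arcosh (x \<bullet> (Qmat *v y))"

definition spatial :: "real ^ ('r::finite) option \<Rightarrow> real ^ 'r" where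
  "spatial x = (\<chi> j. x $ Some j)"

definition hyp_lift :: "real ^ ('r::finite) \<Rightarrow> real ^ 'r option" where
  "hyp_lift v = (\<chi> i. case i of None \<Rightarrow> sqrt (1 + (norm v)\<^sup>2) | Some j \<Rightarrow> v $ j)"

definition Psi :: "real ^ ('r::finite) option \<Rightarrow> (('n::finite) \<Rightarrow> real ^ 'r option) \<Rightarrow> real" where
  "Psi z x = (\<Sum>i\<in>UNIV. (sinh (dist_hyp (x i) z))\<^sup>2)"

end

theory Submission
  imports Defs
begin

text \<open>
  Since \<open>x\<^sup>T Q z \<ge> 1\<close> on the hyperboloid (reverse Cauchy--Schwarz), \<open>sinh\<^sup>2 (arcosh t) = t\<^sup>2 - 1\<close> turns
  \<open>Psi\<close> into a smooth function of the spatial part, although \<open>arcosh\<close> itself is not differentiable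
  at \<open>1\<close>.
\<close>

lemma sum_UNIV_option:
  fixes f :: "'r::finite option \<Rightarrow> 'a::comm_monoid_add"
  shows "sum f UNIV = f None + (\<Sum>j\<in>UNIV. f (Some j))"
  by (simp add: UNIV_option_conv sum.reindex)

lemma Qmat_mult_component: "(Qmat *v y) $ i = (if i = None then y $ i else - y $ i)"
  by (simp add: Qmat_def matrix_vector_mult_def if_distrib[of "\<lambda>c. c * _"] cong: if_cong)

lemma Qmat_inner:
  "x \<bullet> (Qmat *v y) = x $ None * y $ None - spatial x \<bullet> spatial y"
  by (simp add: inner_vec_def sum_UNIV_option Qmat_mult_component spatial_def sum_negf)

lemma hyp_lift_None: "hyp_lift v $ None = sqrt (1 + (norm v)\<^sup>2)"
  and spatial_hyp_lift: "spatial (hyp_lift v) = v"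
  by (simp_all add: hyp_lift_def spatial_def vec_eq_iff)

text \<open>The quadratic equation fixes \<open>x $ None\<close> up to sign; positivity selects the
  positive root.\<close>

lemma hyperboloid_None:
  assumes "x \<in> hyperboloid"
  shows "x $ None = sqrt (1 + (norm (spatial x))\<^sup>2)"
  using assms
  by (intro real_sqrt_unique[symmetric])
    (auto simp: hyperboloid_def Qmat_inner dot_square_norm algebra_simps
      simp flip: power2_eq_square)

text \<open>Cauchy-Schwarz for the plane vectors (1, a) and (1, b): the gap between the squares of
  the two sides is exactly the square of a - b.\<close>

lemma one_plus_mult_le_sqrt: "1 + a * b \<le> sqrt (1 + a\<^sup>2) * sqrt (1 + b\<^sup>2)"
proof -
  have "(1 + a\<^sup>2) * (1 + b\<^sup>2) = (1 + a * b)\<^sup>2 + (a - b)\<^sup>2"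
    by (simp add: power2_eq_square algebra_simps)
  then have "(1 + a * b)\<^sup>2 \<le> (1 + a\<^sup>2) * (1 + b\<^sup>2)"
    by simp
  then show ?thesis
    by (simp add: real_le_rsqrt flip: real_sqrt_mult)
qed

text \<open>Ordinary Cauchy-Schwarz bounds the spatial inner product by the product of the norms,
  which leaves the scalar inequality above.\<close>

lemma one_le_Qmat_inner_hyp_lift:
  assumes "x \<in> hyperboloid"
  shows "1 \<le> x \<bullet> (Qmat *v hyp_lift v)"
  using norm_cauchy_schwarz[of "spatial x" v] one_plus_mult_le_sqrt[of "norm (spatial x)" "norm v"]
  by (simp add: Qmat_inner hyp_lift_None spatial_hyp_lift hyperboloid_None[OF assms])

lemma sinh_arcosh_power2:
  fixes t :: real
  assumes "1 \<le> t"
  shows "(sinh (arcosh t))\<^sup>2 = t\<^sup>2 - 1"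
  using assms by (simp add: sinh_square_eq cosh_arcosh_real)

text \<open>Writing \<open>v \<bullet> v\<close> instead of the squared norm keeps
  \<open>norm\<close>, not differentiable at 0, out of the formula to be differentiated.\<close>

lemma Psi_hyp_lift:
  assumes "\<And>i. x i \<in> hyperboloid"
  shows "Psi (hyp_lift v) x =
    (\<Sum>i\<in>UNIV. (x i $ None * sqrt (1 + v \<bullet> v) - spatial (x i) \<bullet> v)\<^sup>2 - 1)"
  unfolding Psi_def dist_hyp_def sinh_arcosh_power2[OF one_le_Qmat_inner_hyp_lift[OF assms]]
  by (simp add: Qmat_inner hyp_lift_None spatial_hyp_lift power2_norm_eq_inner)

theorem lemma4p1:
  fixes x :: "'n::finite \<Rightarrow> real ^ ('r::finite) option"
    and X :: "real ^ 'r ^ 'n"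
    and u :: "real ^ 'n"
  assumes "\<And>i. x i \<in> hyperboloid"
    and "\<And>i. transpose X *v axis i 1 = spatial (x i)"
    and "\<And>i. u $ i = x i $ None"
  shows "GDERIV (\<lambda>v. Psi (hyp_lift v) x) 0 :> - 2 *\<^sub>R (\<Sum>i\<in>UNIV. x i $ None *\<^sub>R spatial (x i))
    \<and> - 2 *\<^sub>R (\<Sum>i\<in>UNIV. x i $ None *\<^sub>R spatial (x i)) = - 2 *\<^sub>R (transpose X *v u)"
proof
  show "GDERIV (\<lambda>v. Psi (hyp_lift v) x) 0 :> - 2 *\<^sub>R (\<Sum>i\<in>UNIV. x i $ None *\<^sub>R spatial (x i))"
    unfolding Psi_hyp_lift[OF assms(1)] gderiv_def
    \<comment> \<open>At 0 the root equals 1 and has derivative 0, so in direction h the i-th square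
      contributes \<open>- 2 * x i $ None * (spatial (x i) \<bullet> h)\<close>.\<close>
    by (auto intro!: derivative_eq_intros
        simp: fun_eq_iff inner_sum_right sum_distrib_left inner_commute mult_ac sum_negf)
  \<comment> \<open>Expanding \<open>u\<close> in the standard basis leaves only the products
    prescribed by the second assumption.\<close>
  have "transpose X *v u = (\<Sum>i\<in>UNIV. u $ i *\<^sub>R (transpose X *v axis i 1))"
    by (simp add: matrix_mult_sum[of _ u] scalar_mult_eq_scaleR matrix_vector_mult_basis)
  then show "- 2 *\<^sub>R (\<Sum>i\<in>UNIV. x i $ None *\<^sub>R spatial (x i)) = - 2 *\<^sub>R (transpose X *v u)"
    by (simp only: assms(2,3))
qed

end
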